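(* Let $G'$ be a permutation graph and let $G$ be a spanning subgraph of $G'$ with $|E(G')\setminus E(G)|=1$. Then $G$ is $2$-word-$\pi$-representable by two $2$-uniform words, i.e. there exist $2$-uniform words $w,v$ with $\mathrm{alph}(w)=\mathrm{alph}(v)=V(G)$ and $G=G(w,v)$.
   Context: For a word $w$, $\mathrm{alph}(w)$ is the set of letters occurring in $w$ and $|w|_a$ the number of occurrences of $a$; $w$ is $k$-uniform if $|w|_a=k$ for all $a\in\mathrm{alph}(w)$. For letters $a,b$, $\pi_{a,b}$ is the monoid morphism on words with $a\mapsto a$, $b\mapsto b$ and all other letters mapped to the empty word. For words $w,v$ with $\mathrm{alph}(w)=\mathrm{alph}(v)=A$, $G(w,v)$ is the undirected simple graph on vertex set $A$ in which distinct $a,b$ are adjacent iff $\pi_{a,b}(w)=\pi_{a,b}(v)$. For a permutation $\sigma$ of $[n]$, $G(\sigma)$ is the graph on $[n]$ with $\{i,j\}$ an edge iff $(i-j)(\sigma^{-1}(i)-\sigma^{-1}(j))<0$; a permutation graph is a graph isomorphic to some $G(\sigma)$. A spanning subgraph of $G'$ is a subgraph with the same vertex set. *)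

theory Defs
  imports Main "HOL-Combinatorics.Permutations"
begin

type_synonym 'a ugraph = "'a set \<times> 'a set set"

abbreviation verts :: "'a ugraph \<Rightarrow> 'a set" where
  "verts G \<equiv> fst G"

abbreviation edges :: "'a ugraph \<Rightarrow> 'a set set" where
  "edges G \<equiv> snd G"

definition simple_graph :: "'a ugraph \<Rightarrow> bool" where
  "simple_graph G \<longleftrightarrow> finite (verts G) \<and> (\<forall>e \<in> edges G. e \<subseteq> verts G \<and> card e = 2)"

definition spanning_subgraph :: "'a ugraph \<Rightarrow> 'a ugraph \<Rightarrow> bool" where
  "spanning_subgraph G G' \<longleftrightarrow>
     simple_graph G \<and> simple_graph G' \<and> verts G = verts G' \<and> edges G \<subseteq> edges G'"

definition graph_iso :: "'a ugraph \<Rightarrow> 'b ugraph \<Rightarrow> bool" where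
  "graph_iso G H \<longleftrightarrow> (\<exists>f. bij_betw f (verts G) (verts H) \<and>
     (\<forall>a \<in> verts G. \<forall>b \<in> verts G. {a, b} \<in> edges G \<longleftrightarrow> {f a, f b} \<in> edges H))"

definition graph_of_perm :: "nat \<Rightarrow> (nat \<Rightarrow> nat) \<Rightarrow> nat ugraph" where
  "graph_of_perm n \<sigma> =
     ({1..n}, {{i, j} | i j. i \<in> {1..n} \<and> j \<in> {1..n} \<and>
        (int i - int j) * (int (inv \<sigma> i) - int (inv \<sigma> j)) < 0})"

definition permutation_graph :: "'a ugraph \<Rightarrow> bool" where
  "permutation_graph G \<longleftrightarrow> simple_graph G \<and>
     (\<exists>n \<sigma>. \<sigma> permutes {1..n} \<and> graph_iso G (graph_of_perm n \<sigma>))"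

text \<open>Words are lists; the alphabet of \<open>w\<close> is \<open>set w\<close> and the number of
  occurrences of \<open>a\<close> in \<open>w\<close> is \<open>count_list w a\<close>.\<close>

definition uniform_word :: "nat \<Rightarrow> 'a list \<Rightarrow> bool" where
  "uniform_word k w \<longleftrightarrow> (\<forall>a \<in> set w. count_list w a = k)"

definition proj :: "'a \<Rightarrow> 'a \<Rightarrow> 'a list \<Rightarrow> 'a list" where
  "proj a b w = concat (map (\<lambda>x. if x = a \<or> x = b then [x] else []) w)"

text \<open>Only meaningful when \<open>set w = set v\<close>.\<close>

definition graph_of_words :: "'a list \<Rightarrow> 'a list \<Rightarrow> 'a ugraph" where
  "graph_of_words w v =
     (set w, {{a, b} | a b. a \<in> set w \<and> b \<in> set w \<and> a \<noteq> b \<and> proj a b w = proj a b v})"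

end

theory Submission
  imports Defs
begin

text \<open>After reversing one of its two linear orders, a permutation graph \<open>G'\<close> has two linear
  arrangements \<open>p\<close>, \<open>q\<close> of its vertices such that two vertices are adjacent iff \<open>p\<close> and \<open>q\<close>
  order them alike. If \<open>{x, y}\<close> is the removed edge and \<open>c\<close> lists the other vertices, then
  \<open>p c x y\<close> and \<open>q c y x\<close> represent \<open>G\<close>: the second halves agree on every pair of letters
  except \<open>{x, y}\<close>.\<close>

lemma proj_eq_filter: "proj a b w = filter (\<lambda>z. z = a \<or> z = b) w"
  unfolding proj_def by (induction w) auto

lemma proj_append: "proj a b (u @ w) = proj a b u @ proj a b w"
  by (simp add: proj_eq_filter)

text \<open>A distinct list is as long as its set is large, and the projection keeps exactly
  \<open>a\<close> and \<open>b\<close>. This length is what later allows an equation between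
  concatenated projections to be split.\<close>

lemma length_proj_distinct:
  assumes "distinct p" "a \<in> set p" "b \<in> set p" "a \<noteq> b"
  shows "length (proj a b p) = 2"
proof -
  have "set (proj a b p) = {a, b}" using assms by (auto simp: proj_eq_filter)
  moreover have "distinct (proj a b p)" using assms by (simp add: proj_eq_filter)
  ultimately show ?thesis using assms(4) by (metis distinct_card card_2_iff)
qed

text \<open>Injectivity of the key rules out ties, so sorting by \<open>k\<close> is strict.\<close>

lemma obtain_list_sorted_by_key:
  fixes k :: "'a \<Rightarrow> 'b::linorder"
  assumes "finite V" "inj_on k V"
  obtains p where "set p = V" "distinct p" "sorted_wrt (\<lambda>a b. k a < k b) p"
proof -
  obtain xs where xs: "set xs = V" "distinct xs"
    using assms(1) finite_distinct_list by blast
  have "sorted (map k (sort_key k xs))" by simp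
  moreover have "distinct (map k (sort_key k xs))"
    using xs assms(2) by (simp add: distinct_map)
  ultimately have "sorted_wrt (<) (map k (sort_key k xs))"
    by (simp add: strict_sorted_iff)
  then have "sorted_wrt (\<lambda>a b. k a < k b) (sort_key k xs)"
    by (simp add: sorted_wrt_map)
  with xs show thesis by (intro that[of "sort_key k xs"]) auto
qed

text \<open>The two-letter projection inherits strict increase from \<open>p\<close>, which leaves
  only one possible order of \<open>a\<close> and \<open>b\<close>. Comparing projections thereby
  becomes comparing keys.\<close>

lemma proj_sorted_by_key:
  fixes k :: "'a \<Rightarrow> 'b::linorder"
  assumes "distinct p" "sorted_wrt (\<lambda>a b. k a < k b) p" "a \<in> set p" "b \<in> set p" "a \<noteq> b"
  shows "proj a b p = (if k a < k b then [a, b] else [b, a])"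
proof -
  have "length (proj a b p) = 2" using assms length_proj_distinct by metis
  then obtain c d where cd: "proj a b p = [c, d]"
    by (metis (no_types, lifting) One_nat_def Suc_1 length_0_conv length_Suc_conv)
  have "set (proj a b p) = {a, b}" using assms by (auto simp: proj_eq_filter)
  moreover have "sorted_wrt (\<lambda>a b. k a < k b) (proj a b p)"
    using assms(2) by (simp add: proj_eq_filter sorted_wrt_filter)
  ultimately show ?thesis using cd assms(5) by (auto simp: doubleton_eq_iff)
qed

lemma permutation_graph_arrangements:
  assumes "permutation_graph G"
  obtains p q where "set p = verts G" "distinct p" "set q = verts G" "distinct q"
    "\<And>a b. \<lbrakk>a \<in> verts G; b \<in> verts G; a \<noteq> b\<rbrakk> \<Longrightarrow>
       {a, b} \<in> edges G \<longleftrightarrow> proj a b p = proj a b q"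
proof -
  obtain n \<sigma> f where \<sigma>: "\<sigma> permutes {1..n}"
    and f: "bij_betw f (verts G) {1..n}"
    and e: "\<And>a b. \<lbrakk>a \<in> verts G; b \<in> verts G\<rbrakk> \<Longrightarrow>
        {a, b} \<in> edges G \<longleftrightarrow> {f a, f b} \<in> edges (graph_of_perm n \<sigma>)"
    using assms unfolding permutation_graph_def graph_iso_def
    by (auto simp: graph_of_perm_def)
  have fin: "finite (verts G)"
    using assms by (simp add: permutation_graph_def simple_graph_def)
  have inj: "inj_on f (verts G)" using f by (simp add: bij_betw_def)
  have inj_inv: "inj (inv \<sigma>)" using permutes_inv[OF \<sigma>] permutes_inj by blast
  \<comment> \<open>Edges of \<open>graph_of_perm\<close> are inversions, pairs on which position
    and value disagree. The minus sign in \<open>?l\<close> reverses the second order, so that edges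
    become pairs on which the two keys agree.\<close>
  let ?k = "\<lambda>a. int (f a)" and ?l = "\<lambda>a. - int (inv \<sigma> (f a))"
  have "inj_on ?k (verts G)" using inj by (auto simp: inj_on_def)
  then obtain p where p: "set p = verts G" "distinct p" "sorted_wrt (\<lambda>a b. ?k a < ?k b) p"
    using fin obtain_list_sorted_by_key by blast
  have "inj_on ?l (verts G)" using inj inj_inv by (auto simp: inj_on_def inj_def)
  then obtain q where q: "set q = verts G" "distinct q" "sorted_wrt (\<lambda>a b. ?l a < ?l b) q"
    using fin obtain_list_sorted_by_key by blast
  have "{a, b} \<in> edges G \<longleftrightarrow> proj a b p = proj a b q"
    if ab: "a \<in> verts G" "b \<in> verts G" "a \<noteq> b" for a b
  proof -
    \<comment> \<open>The defining product is unchanged when its two indices are swapped, so it does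
      not matter which way the edge \<open>{f a, f b}\<close> is read as
      \<open>{i, j}\<close>.\<close>
    have "f a \<in> {1..n}" "f b \<in> {1..n}" using f ab by (auto dest: bij_betwE)
    then have "{a, b} \<in> edges G \<longleftrightarrow> (?k a - ?k b) * (?l b - ?l a) < 0"
      using e[OF ab(1,2)]
      by (auto simp: graph_of_perm_def doubleton_eq_iff mult_less_0_iff)
    moreover have "?k a \<noteq> ?k b" "?l a \<noteq> ?l b"
      using inj inj_inv ab by (auto simp: inj_on_def inj_def)
    ultimately have "{a, b} \<in> edges G \<longleftrightarrow> (?k a < ?k b \<longleftrightarrow> ?l a < ?l b)"
      by (auto simp: mult_less_0_iff)
    moreover have "proj a b p = (if ?k a < ?k b then [a, b] else [b, a])"
      using proj_sorted_by_key[OF p(2,3)] p(1) ab by simp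
    moreover have "proj a b q = (if ?l a < ?l b then [a, b] else [b, a])"
      using proj_sorted_by_key[OF q(2,3)] q(1) ab by simp
    ultimately show ?thesis using ab(3) by (auto split: if_splits)
  qed
  with p q show thesis by (intro that) auto
qed

lemma uniform_word_append_distinct:
  fixes u w :: "'a list"
  assumes "distinct u" "distinct w" "set u = set w"
  shows "uniform_word 2 (u @ w)"
proof -
  have "count_list xs a = 1" if "distinct xs" "a \<in> set xs" for xs :: "'a list" and a
    using that by (induction xs) auto
  with assms show ?thesis by (simp add: uniform_word_def)
qed

theorem theorem3:
  fixes G G' :: "'a ugraph"
  assumes "permutation_graph G'"
    and "spanning_subgraph G G'"
    and "card (edges G' - edges G) = 1"
  shows "\<exists>w v :: 'a list. uniform_word 2 w \<and> uniform_word 2 v \<and>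
           set w = verts G \<and> set v = verts G \<and> G = graph_of_words w v"
proof -
  have V: "verts G' = verts G" and sub: "edges G \<subseteq> edges G'"
    and sG: "simple_graph G" and sG': "simple_graph G'"
    using assms(2) by (auto simp: spanning_subgraph_def)
  obtain e where e: "edges G' - edges G = {e}"
    using assms(3) card_1_singletonE by blast
  then have "e \<in> edges G'" by blast
  then have "e \<subseteq> verts G" "card e = 2" using sG' V by (auto simp: simple_graph_def)
  then obtain x y where exy: "e = {x, y}" and xy: "x \<noteq> y" "x \<in> verts G" "y \<in> verts G"
    by (auto simp: card_2_iff)
  have "edges G = edges G' - (edges G' - edges G)" using sub by (simp add: double_diff)
  then have edgesG: "edges G = edges G' - {{x, y}}" unfolding e exy .
  obtain p q where p: "set p = verts G" "distinct p" and q: "set q = verts G" "distinct q"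
    and pq: "\<And>a b. \<lbrakk>a \<in> verts G; b \<in> verts G; a \<noteq> b\<rbrakk> \<Longrightarrow>
       {a, b} \<in> edges G' \<longleftrightarrow> proj a b p = proj a b q"
    using permutation_graph_arrangements[OF assms(1)] V by metis
  have "finite (verts G - {x, y})" using sG by (simp add: simple_graph_def)
  from finite_distinct_list[OF this]
  obtain c where c: "set c = verts G - {x, y}" "distinct c" by (elim exE conjE)
  \<comment> \<open>A pair other than \<open>{x, y}\<close> has at most one letter in the final two
    places, so swapping these is invisible to its projection.\<close>
  let ?s = "c @ [x, y]" and ?t = "c @ [y, x]"
  have s: "set ?s = verts G" "distinct ?s" and t: "set ?t = verts G" "distinct ?t"
    using c xy by auto
  let ?w = "p @ ?s" and ?v = "q @ ?t"
  have edge: "{a, b} \<in> edges G \<longleftrightarrow> proj a b ?w = proj a b ?v"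
    if ab: "a \<in> verts G" "b \<in> verts G" "a \<noteq> b" for a b
  proof -
    \<comment> \<open>Prefixes of equal length let the equation split into halves: the first decides
      adjacency in \<open>G'\<close>, the second fails only for the removed edge.\<close>
    have "length (proj a b p) = length (proj a b q)"
      using length_proj_distinct p q ab by metis
    then have "proj a b ?w = proj a b ?v \<longleftrightarrow>
        proj a b p = proj a b q \<and> proj a b ?s = proj a b ?t"
      by (simp only: proj_append[of a b p] proj_append[of a b q] append_eq_append_conv simp_thms)
    moreover have "proj a b ?s = proj a b ?t \<longleftrightarrow> {a, b} \<noteq> {x, y}"
      using ab(3) xy(1) by (auto simp: proj_eq_filter doubleton_eq_iff)
    moreover have "{a, b} \<in> edges G \<longleftrightarrow> {a, b} \<in> edges G' \<and> {a, b} \<noteq> {x, y}"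
      by (simp add: edgesG)
    ultimately show ?thesis using pq[OF ab] by simp
  qed
  have sets: "set ?w = verts G" "set ?v = verts G" using p q s t by auto
  \<comment> \<open>Edges of the simple graph \<open>G\<close> are two-element sets of vertices, so
    \<open>edge\<close> covers all of them.\<close>
  have "edges G = edges (graph_of_words ?w ?v)"
  proof (intro equalityI subsetI)
    fix d assume d: "d \<in> edges G"
    then have "d \<subseteq> verts G" "card d = 2" using sG by (simp_all add: simple_graph_def)
    then obtain a b where ab: "d = {a, b}" "a \<in> verts G" "b \<in> verts G" "a \<noteq> b"
      by (auto simp: card_2_iff)
    then have "proj a b ?w = proj a b ?v" using d edge by simp
    with ab show "d \<in> edges (graph_of_words ?w ?v)"
      unfolding graph_of_words_def sets snd_conv by blast
  next
    fix d assume "d \<in> edges (graph_of_words ?w ?v)"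
    then obtain a b where "d = {a, b}" "a \<in> verts G" "b \<in> verts G" "a \<noteq> b"
      "proj a b ?w = proj a b ?v"
      unfolding graph_of_words_def sets snd_conv by blast
    then show "d \<in> edges G" using edge by simp
  qed
  moreover have "verts (graph_of_words ?w ?v) = verts G"
    using sets by (simp add: graph_of_words_def)
  ultimately have "G = graph_of_words ?w ?v" by (simp add: prod_eq_iff)
  moreover have "uniform_word 2 ?w"
    using p s by (intro uniform_word_append_distinct) simp_all
  moreover have "uniform_word 2 ?v"
    using q t by (intro uniform_word_append_distinct) simp_all
  ultimately show ?thesis using sets by blast
qed

end
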